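(* Let $\alpha$ be a composition of $n$ and let $\rho\in\mathfrak{S}_n$ satisfy $w_0(\alpha)\preceq_L\rho$. Then the diagram $D_{\alpha;\rho}\subseteq\mathbb{N}^2$ produced from $(\alpha,\rho)$ by the algorithm in the context satisfies $$\Sigma_R(P_{D_{\alpha;\rho}})=\{w_0\gamma^{-1}:\gamma\in[w_0(\alpha),\rho]_L\}\ \big(=[w_0\rho^{-1},\,w_0\,w_0(\alpha)^{-1}]_R\big).$$
   Context: Permutations in $\mathfrak{S}_n$ are composed as functions, $(\sigma\tau)(i)=\sigma(\tau(i))$; $s_i=(i\ i{+}1)$; $\ell$ is the length; $\mathrm{Des}_L(\sigma)=\{i\in[n-1]:\ell(s_i\sigma)<\ell(\sigma)\}$. The left (resp. right) weak Bruhat order $\preceq_L$ (resp. $\preceq_R$) has covers $\sigma\prec s_i\sigma$ when $\ell(s_i\sigma)>\ell(\sigma)$ (resp. $\sigma\prec\sigma s_i$ when $\ell(\sigma s_i)>\ell(\sigma)$); $[\sigma,\rho]_L$, $[\sigma,\rho]_R$ denote intervals. $w_0$ is the longest element of $\mathfrak{S}_n$. For $\alpha\models n$, $\mathrm{set}(\alpha)=\{\alpha_1,\alpha_1+\alpha_2,\dots,\alpha_1+\cdots+\alpha_{\ell(\alpha)-1}\}\subseteq[n-1]$, $\alpha^{\mathrm c}$ is the composition with $\mathrm{set}(\alpha^{\mathrm c})=[n-1]\setminus\mathrm{set}(\alpha)$, and $w_0(\alpha)$ is the longest element of the parabolic subgroup generated by $\{s_i:i\in\mathrm{set}(\alpha)\}$.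 For a poset $P$ on $[n]$, $\Sigma_R(P)=\{\sigma\in\mathfrak{S}_n:\sigma^{-1}(i)<\sigma^{-1}(j)\text{ whenever }i\prec_P j\}$. Let $\mathfrak{D}_n$ be the set of $n$-element subsets $D$ of $\mathbb{N}^2$ ($\mathbb{N}=\{1,2,\dots\}$) whose set of first coordinates is $[l]$ and whose set of second coordinates is $[k]$ for some $k,l$. $D$ is viewed as a diagram of boxes in the first quadrant, box $(x,y)$ being in column $x$ (from the left) and row $y$ (from the bottom). For $D\in\mathfrak{D}_n$, let $(x_i,y_i)$ be the $i$th element of $D$ when its elements are enumerated along rows from left to right, starting with the uppermost row. $P_D$ is the poset on $[n]$ with $i\preceq_{P_D}j$ iff $x_i\le x_j$ and $y_i\le y_j$. Algorithm (input $\alpha\models n$ and $\rho$ with $w_0(\alpha)\preceq_L\rho$): Step 1. Let $\mathrm{set}(\alpha^{\mathrm c})=\{z_1<\cdots<z_l\}$, $z_0=0$, $z_{l+1}=n$; for $1\le j\le l+1$ let $R_j(\alpha;\rho)=\{\rho(r):z_{j-1}+1\le r\le z_j\}$. Step 2. Let $\mathrm{Des}_L(\rho)=\{k_1<\cdots<k_e\}$, $k_0=0$, $k_{e+1}=n$; for $1\le i\le e+1$ let $C_i(\alpha;\rho)=\{c:k_{i-1}+1\le c\le k_i\}$. Step 3. Return $D_{\alpha;\rho}=\{(i,j)\in\mathbb{N}^2: R_j(\alpha;\rho)\cap C_i(\alpha;\rho)\ne\emptyset\}$. (This $D_{\alpha;\rho}$ belongs to $\mathfrak{D}_n$.) *)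

theory Defs
  imports "HOL-Algebra.Sym_Groups"
begin

(* The symmetric group on [n] is the library's "sym_group n": its elements are the
   functions on nat permuting {1..n}, multiplied by composition. Inverse functions are
   written inv', because HOL-Algebra uses inv for inverses in a group. *)

abbreviation simple_refl :: "nat \<Rightarrow> nat \<Rightarrow> nat"
  where "simple_refl i \<equiv> transpose i (Suc i)"

definition perm_length :: "nat \<Rightarrow> (nat \<Rightarrow> nat) \<Rightarrow> nat" where
  "perm_length n \<sigma> =
     (LEAST k. \<exists>is. length is = k \<and> set is \<subseteq> {1..<n} \<and>
                    \<sigma> = foldr (\<lambda>i \<tau>. simple_refl i \<circ> \<tau>) is id)"

definition Des_L :: "nat \<Rightarrow> (nat \<Rightarrow> nat) \<Rightarrow> nat set" where
  "Des_L n \<sigma> = {i \<in> {1..<n}. perm_length n (simple_refl i \<circ> \<sigma>) < perm_length n \<sigma>}"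

definition left_cover :: "nat \<Rightarrow> (nat \<Rightarrow> nat) \<Rightarrow> (nat \<Rightarrow> nat) \<Rightarrow> bool" where
  "left_cover n \<sigma> \<tau> \<longleftrightarrow> \<sigma> \<in> carrier (sym_group n) \<and>
     (\<exists>i\<in>{1..<n}. \<tau> = simple_refl i \<circ> \<sigma> \<and> perm_length n \<tau> > perm_length n \<sigma>)"

definition right_cover :: "nat \<Rightarrow> (nat \<Rightarrow> nat) \<Rightarrow> (nat \<Rightarrow> nat) \<Rightarrow> bool" where
  "right_cover n \<sigma> \<tau> \<longleftrightarrow> \<sigma> \<in> carrier (sym_group n) \<and>
     (\<exists>i\<in>{1..<n}. \<tau> = \<sigma> \<circ> simple_refl i \<and> perm_length n \<tau> > perm_length n \<sigma>)"

definition weak_le_L :: "nat \<Rightarrow> (nat \<Rightarrow> nat) \<Rightarrow> (nat \<Rightarrow> nat) \<Rightarrow> bool" where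
  "weak_le_L n = (left_cover n)\<^sup>*\<^sup>*"

definition weak_le_R :: "nat \<Rightarrow> (nat \<Rightarrow> nat) \<Rightarrow> (nat \<Rightarrow> nat) \<Rightarrow> bool" where
  "weak_le_R n = (right_cover n)\<^sup>*\<^sup>*"

definition interval_L :: "nat \<Rightarrow> (nat \<Rightarrow> nat) \<Rightarrow> (nat \<Rightarrow> nat) \<Rightarrow> (nat \<Rightarrow> nat) set" where
  "interval_L n \<sigma> \<rho> = {\<gamma> \<in> carrier (sym_group n). weak_le_L n \<sigma> \<gamma> \<and> weak_le_L n \<gamma> \<rho>}"

definition interval_R :: "nat \<Rightarrow> (nat \<Rightarrow> nat) \<Rightarrow> (nat \<Rightarrow> nat) \<Rightarrow> (nat \<Rightarrow> nat) set" where
  "interval_R n \<sigma> \<rho> = {\<gamma> \<in> carrier (sym_group n). weak_le_R n \<sigma> \<gamma> \<and> weak_le_R n \<gamma> \<rho>}"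

definition longest_element :: "nat \<Rightarrow> (nat \<Rightarrow> nat) set \<Rightarrow> nat \<Rightarrow> nat" where
  "longest_element n G =
     (THE w. w \<in> G \<and> (\<forall>v\<in>G. v \<noteq> w \<longrightarrow> perm_length n v < perm_length n w))"

definition w0 :: "nat \<Rightarrow> nat \<Rightarrow> nat" where
  "w0 n = longest_element n (carrier (sym_group n))"

definition composition_of :: "nat \<Rightarrow> nat list \<Rightarrow> bool" where
  "composition_of n \<alpha> \<longleftrightarrow> (\<forall>a\<in>set \<alpha>. a > 0) \<and> sum_list \<alpha> = n"

definition comp_set :: "nat list \<Rightarrow> nat set" where
  "comp_set \<alpha> = {sum_list (take i \<alpha>) | i. 1 \<le> i \<and> i < length \<alpha>}"

definition comp_compl :: "nat \<Rightarrow> nat list \<Rightarrow> nat list" where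
  "comp_compl n \<alpha> = (THE \<beta>. composition_of n \<beta> \<and> comp_set \<beta> = {1..<n} - comp_set \<alpha>)"

definition w0_comp :: "nat \<Rightarrow> nat list \<Rightarrow> nat \<Rightarrow> nat" where
  "w0_comp n \<alpha> = longest_element n (generate (sym_group n) (simple_refl ` comp_set \<alpha>))"

(* A poset on [n] is given by its order relation, as a set of pairs. *)
definition Sigma_R :: "nat \<Rightarrow> (nat \<times> nat) set \<Rightarrow> (nat \<Rightarrow> nat) set" where
  "Sigma_R n P = {\<sigma> \<in> carrier (sym_group n).
                   \<forall>i j. (i, j) \<in> P \<and> i \<noteq> j \<longrightarrow> inv' \<sigma> i < inv' \<sigma> j}"

(* Boxes are pairs (column, row), both counted from 1; l = 0 or k = 0 is possible
   only for n = 0. *)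
definition diagrams :: "nat \<Rightarrow> (nat \<times> nat) set set" where
  "diagrams n = {D. finite D \<and> card D = n \<and> (\<exists>l. fst ` D = {1..l}) \<and> (\<exists>k. snd ` D = {1..k})}"

definition reading_less :: "nat \<times> nat \<Rightarrow> nat \<times> nat \<Rightarrow> bool" where
  "reading_less p q \<longleftrightarrow> snd q < snd p \<or> (snd p = snd q \<and> fst p < fst q)"

definition box_list :: "(nat \<times> nat) set \<Rightarrow> (nat \<times> nat) list" where
  "box_list D = (THE bs. set bs = D \<and> sorted_wrt reading_less bs)"

definition diagram_poset :: "(nat \<times> nat) set \<Rightarrow> (nat \<times> nat) set" where
  "diagram_poset D = {(i, j). i \<in> {1..card D} \<and> j \<in> {1..card D} \<and>
     fst (box_list D ! (i - 1)) \<le> fst (box_list D ! (j - 1)) \<and>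
     snd (box_list D ! (i - 1)) \<le> snd (box_list D ! (j - 1))}"

(* The list 0 = z_0, z_1, ..., z_l, z_(l+1) = n, for a set {z_1 < ... < z_l} of cut points. *)
definition cuts :: "nat \<Rightarrow> nat set \<Rightarrow> nat list" where
  "cuts n Z = 0 # sorted_list_of_set Z @ [n]"

definition row_block :: "nat \<Rightarrow> nat list \<Rightarrow> (nat \<Rightarrow> nat) \<Rightarrow> nat \<Rightarrow> nat set" where
  "row_block n \<alpha> \<rho> j =
     (let z = cuts n (comp_set (comp_compl n \<alpha>)) in \<rho> ` {z ! (j - 1) + 1 .. z ! j})"

definition col_block :: "nat \<Rightarrow> (nat \<Rightarrow> nat) \<Rightarrow> nat \<Rightarrow> nat set" where
  "col_block n \<rho> i = (let k = cuts n (Des_L n \<rho>) in {k ! (i - 1) + 1 .. k ! i})"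

definition alg_diagram :: "nat \<Rightarrow> nat list \<Rightarrow> (nat \<Rightarrow> nat) \<Rightarrow> (nat \<times> nat) set" where
  "alg_diagram n \<alpha> \<rho> = {(i, j).
     i \<in> {1 .. card (Des_L n \<rho>) + 1} \<and>
     j \<in> {1 .. card (comp_set (comp_compl n \<alpha>)) + 1} \<and>
     row_block n \<alpha> \<rho> j \<inter> col_block n \<rho> i \<noteq> {}}"

end

(* Everything is read off position inversions: the length is their number and the left weak order
   is their inclusion. Hence w_0(alpha) <=_L gamma says that gamma is decreasing on each row
   block of positions, since the inversions of w_0(alpha) are exactly the pairs inside a block.

   The value rho(p) contributes the box (column of rho(p), row of p), and distinct values give
   distinct boxes: rho decreases on a row block, while the inverse of rho increases on a column
   block. The reading order runs through p = n, ..., 1, so the i-th box belongs to p = n + 1 - i.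
   For sigma = w_0 gamma^{-1} one has sigma^{-1}(i) = gamma(n + 1 - i), and sigma is a linear
   extension of the diagram poset iff gamma(p) < gamma(q) whenever p's box is weakly
   below and left of q's. Such a pair either lies in one row, where it expresses that gamma
   decreases on the row block, or satisfies p < q and rho(p) < rho(q), where it expresses that
   gamma has no inversion outside those of rho. *)

theory Submission
  imports Defs
begin

subsection \<open>Inversions, length and the weak orders\<close>

text \<open>Pairs of positions, not of values: a simple reflection on the left exchanges two
  adjacent values, which alters this set by a single pair.\<close>

definition inversions :: "nat \<Rightarrow> (nat \<Rightarrow> nat) \<Rightarrow> (nat \<times> nat) set" where
  "inversions n \<sigma> = {(a, b). 1 \<le> a \<and> a < b \<and> b \<le> n \<and> \<sigma> b < \<sigma> a}"

lemma finite_inversions [simp]: "finite (inversions n \<sigma>)"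
  by (rule finite_subset[of _ "{1..n} \<times> {1..n}"]) (auto simp: inversions_def)

lemma inversions_id [simp]: "inversions n id = {}"
  by (auto simp: inversions_def)

lemma simple_refl_permutes:
  assumes "i \<in> {1..<n}"
  shows "simple_refl i permutes {1..n}"
  using assms by (intro permutes_swap_id) auto

lemma simple_refl_comp_permutes:
  assumes "\<sigma> permutes {1..n}" and "i \<in> {1..<n}"
  shows "simple_refl i \<circ> \<sigma> permutes {1..n}"
  using assms by (intro permutes_compose simple_refl_permutes)

text \<open>No value lies strictly between i and i + 1, so exchanging the two affects only the
  comparison between their own positions.\<close>

lemma inversions_simple_refl:
  assumes "\<sigma> permutes {1..n}" "i \<in> {1..<n}" and less: "inv' \<sigma> i < inv' \<sigma> (Suc i)"
  shows "inversions n (simple_refl i \<circ> \<sigma>) = insert (inv' \<sigma> i, inv' \<sigma> (Suc i)) (inversions n \<sigma>)"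
    and "(inv' \<sigma> i, inv' \<sigma> (Suc i)) \<notin> inversions n \<sigma>"
proof -
  define a b where "a = inv' \<sigma> i" and "b = inv' \<sigma> (Suc i)"
  have ab: "\<sigma> a = i" "\<sigma> b = Suc i"
    using permutes_inverses(1)[OF assms(1)] by (simp_all add: a_def b_def)
  have inj: "\<sigma> c = i \<longleftrightarrow> c = a" "\<sigma> c = Suc i \<longleftrightarrow> c = b" for c
    using permutes_inj[OF assms(1)] ab by (metis injD)+
  have "a \<in> {1..n}" "b \<in> {1..n}"
    using permutes_in_image[OF assms(1)] ab assms(2)
    by (metis atLeastAtMost_iff atLeastLessThan_iff less_imp_le Suc_leI le_Suc_eq)+
  then have mem: "1 \<le> a" "b \<le> n" by auto
  have "a < b" using less by (simp add: a_def b_def)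
  have swap: "simple_refl i (\<sigma> d) < simple_refl i (\<sigma> c) \<longleftrightarrow> \<sigma> d < \<sigma> c \<or> c = a \<and> d = b"
    if "c < d" for c d
  proof -
    have "\<not> (c = b \<and> d = a)" "\<sigma> c \<noteq> \<sigma> d"
      using that \<open>a < b\<close> permutes_inj[OF assms(1)] by (auto dest: injD)
    then show ?thesis
      unfolding inj[symmetric] transpose_def by auto
  qed
  show "inversions n (simple_refl i \<circ> \<sigma>) = insert (inv' \<sigma> i, inv' \<sigma> (Suc i)) (inversions n \<sigma>)"
    using swap mem \<open>a < b\<close> unfolding a_def[symmetric] b_def[symmetric]
    by (auto simp: inversions_def)
  show "(inv' \<sigma> i, inv' \<sigma> (Suc i)) \<notin> inversions n \<sigma>"
    using ab unfolding a_def[symmetric] b_def[symmetric] by (auto simp: inversions_def)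
qed

lemma inv_simple_refl_comp:
  assumes "\<sigma> permutes {1..n}"
  shows "inv' (simple_refl i \<circ> \<sigma>) = inv' \<sigma> \<circ> simple_refl i"
  using permutes_bij[OF assms] by (simp add: o_inv_distrib)

lemma card_inversions_ascent:
  assumes "\<sigma> permutes {1..n}" "i \<in> {1..<n}" "inv' \<sigma> i < inv' \<sigma> (Suc i)"
  shows "card (inversions n (simple_refl i \<circ> \<sigma>)) = Suc (card (inversions n \<sigma>))"
  using inversions_simple_refl[OF assms] by simp

text \<open>The ascent case applies to \<open>simple_refl i \<circ> \<sigma>\<close>, and reflecting
  again returns to \<sigma>.\<close>

lemma card_inversions_descent:
  assumes "\<sigma> permutes {1..n}" "i \<in> {1..<n}" "inv' \<sigma> (Suc i) < inv' \<sigma> i"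
  shows "card (inversions n \<sigma>) = Suc (card (inversions n (simple_refl i \<circ> \<sigma>)))"
proof -
  have "simple_refl i \<circ> (simple_refl i \<circ> \<sigma>) = \<sigma>"
    by (auto simp: fun_eq_iff)
  then show ?thesis
    using card_inversions_ascent[OF simple_refl_comp_permutes[OF assms(1,2)] assms(2)] assms(3)
    by (simp add: inv_simple_refl_comp[OF assms(1)])
qed

lemma permutes_inv_neq:
  assumes "\<sigma> permutes S" "a \<noteq> b"
  shows "inv' \<sigma> a \<noteq> inv' \<sigma> b"
  using assms by (metis permutes_inverses(1))

text \<open>Without a descent \<pi> would increase strictly on [n], which keeps it above the
  identity when read from 1 and below it when read from n.\<close>

lemma permutes_exists_descent:
  assumes "\<pi> permutes {1..n}" "\<pi> \<noteq> id"
  shows "\<exists>i\<in>{1..<n}. \<pi> (Suc i) < \<pi> i"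
proof (rule ccontr)
  assume "\<not> ?thesis"
  then have step: "\<pi> i < \<pi> (Suc i)" if "i \<in> {1..<n}" for i
    using that permutes_inj[OF assms(1)] by (metis injD linorder_neqE_nat n_not_Suc_n)
  have mem: "\<pi> i \<in> {1..n}" if "i \<in> {1..n}" for i
    using that assms(1) by (simp add: permutes_in_image del: atLeastAtMost_iff)
  have lower: "1 \<le> i \<Longrightarrow> i \<le> n \<Longrightarrow> i \<le> \<pi> i" for i
  proof (induction i)
    case (Suc i)
    show ?case
    proof (cases "i = 0")
      case True
      then show ?thesis using mem[of 1] Suc.prems by auto
    next
      case False
      then show ?thesis using Suc step[of i] by auto
    qed
  qed simp
  \<comment> \<open>The induction runs downwards from n, with k the distance from n.\<close>
  have upper: "k < n \<Longrightarrow> \<pi> (n - k) \<le> n - k" for k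
  proof (induction k)
    case 0
    then show ?case using mem[of n] by auto
  next
    case (Suc k)
    then have "\<pi> (n - Suc k) < \<pi> (Suc (n - Suc k))" by (intro step) auto
    moreover have "Suc (n - Suc k) = n - k" using Suc.prems by auto
    ultimately show ?case using Suc by auto
  qed
  have "\<pi> i = i" for i
  proof (cases "i \<in> {1..n}")
    case True
    then show ?thesis using lower[of i] upper[of "n - i"] by auto
  qed (use assms(1) in \<open>simp add: permutes_not_in\<close>)
  with assms(2) show False by auto
qed

section \<open>Length as the number of inversions\<close>

abbreviation simple_word :: "nat list \<Rightarrow> nat \<Rightarrow> nat" where
  "simple_word is \<equiv> foldr (\<lambda>i \<tau>. simple_refl i \<circ> \<tau>) is id"

lemma simple_word_Cons: "simple_word (i # is) = simple_refl i \<circ> simple_word is"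
  by simp

text \<open>Each letter raises or lowers the number of inversions by exactly one.\<close>

lemma card_inversions_simple_word:
  "set is \<subseteq> {1..<n} \<Longrightarrow> simple_word is permutes {1..n} \<and> card (inversions n (simple_word is)) \<le> length is"
proof (induction "is")
  case (Cons i "is")
  then have "set is \<subseteq> {1..<n}" and i: "i \<in> {1..<n}" by simp_all
  from Cons.IH[OF this(1)] have IH: "simple_word is permutes {1..n}"
    "card (inversions n (simple_word is)) \<le> length is" by (rule conjunct1, rule conjunct2)
  have "inv' (simple_word is) i < inv' (simple_word is) (Suc i)
      \<or> inv' (simple_word is) (Suc i) < inv' (simple_word is) i"
    using permutes_inv_neq[OF IH(1), of i "Suc i"] by auto
  then have "card (inversions n (simple_refl i \<circ> simple_word is)) \<le> Suc (length is)"
    using card_inversions_ascent[OF IH(1) i] card_inversions_descent[OF IH(1) i] IH(2) by auto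
  then show ?case
    using simple_refl_comp_permutes[OF IH(1) i] unfolding simple_word_Cons
    by (simp only: list.size add_Suc_right add_0_right simp_thms)
qed (simp add: permutes_id)

text \<open>Sorting: unless \<sigma> is the identity, some i + 1 stands before i, and exchanging
  them removes one inversion. This costs one letter per inversion.\<close>

lemma exists_simple_word:
  assumes "\<sigma> permutes {1..n}"
  shows "\<exists>is. length is = card (inversions n \<sigma>) \<and> set is \<subseteq> {1..<n} \<and> \<sigma> = simple_word is"
  using assms
proof (induction "card (inversions n \<sigma>)" arbitrary: \<sigma> rule: less_induct)
  case less
  show ?case
  proof (cases "\<sigma> = id")
    case True
    then show ?thesis by (intro exI[of _ "[]"]) simp
  next
    case False
    \<comment> \<open>The descent is sought in the inverse because reflections on the left act on
      values.\<close>
    then have "inv' \<sigma> \<noteq> id"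
      using less.prems by (metis inv_id permutes_inv_inv)
    then obtain i where i: "i \<in> {1..<n}" "inv' \<sigma> (Suc i) < inv' \<sigma> i"
      using permutes_exists_descent[OF permutes_inv[OF less.prems]] by auto
    note c = card_inversions_descent[OF less.prems i]
    have "card (inversions n (simple_refl i \<circ> \<sigma>)) < card (inversions n \<sigma>)"
      using c by simp
    from less.hyps[OF this simple_refl_comp_permutes[OF less.prems i(1)]]
    obtain ks where ks: "length ks = card (inversions n (simple_refl i \<circ> \<sigma>))"
      "set ks \<subseteq> {1..<n}" "simple_refl i \<circ> \<sigma> = simple_word ks" by blast
    have "\<sigma> = simple_refl i \<circ> (simple_refl i \<circ> \<sigma>)"
      by (auto simp: fun_eq_iff)
    also have "\<dots> = simple_word (i # ks)" using ks(3) by simp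
    finally show ?thesis
      using ks i c by (intro exI[of _ "i # ks"]) simp
  qed
qed

lemma perm_length_eq_card_inversions:
  assumes "\<sigma> permutes {1..n}"
  shows "perm_length n \<sigma> = card (inversions n \<sigma>)"
  unfolding perm_length_def
proof (rule Least_equality)
  show "\<exists>is. length is = card (inversions n \<sigma>) \<and> set is \<subseteq> {1..<n} \<and> \<sigma> = simple_word is"
    using exists_simple_word[OF assms] .
qed (use card_inversions_simple_word in blast)

lemma perm_length_simple_refl_less_iff:
  assumes "\<sigma> permutes {1..n}" "i \<in> {1..<n}"
  shows "perm_length n (simple_refl i \<circ> \<sigma>) < perm_length n \<sigma> \<longleftrightarrow> inv' \<sigma> (Suc i) < inv' \<sigma> i"
    and "perm_length n \<sigma> < perm_length n (simple_refl i \<circ> \<sigma>) \<longleftrightarrow> inv' \<sigma> i < inv' \<sigma> (Suc i)"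
  using card_inversions_ascent[OF assms] card_inversions_descent[OF assms]
    permutes_inv_neq[OF assms(1), of i "Suc i"]
  unfolding perm_length_eq_card_inversions[OF assms(1)]
    perm_length_eq_card_inversions[OF simple_refl_comp_permutes[OF assms]]
  by linarith+

section \<open>Descents and the left weak order\<close>

lemma Des_L_eq:
  assumes "\<sigma> permutes {1..n}"
  shows "Des_L n \<sigma> = {i \<in> {1..<n}. inv' \<sigma> (Suc i) < inv' \<sigma> i}"
  using perm_length_simple_refl_less_iff(1)[OF assms] by (auto simp: Des_L_def)

lemma left_cover_iff:
  "left_cover n \<sigma> \<tau> \<longleftrightarrow> \<sigma> permutes {1..n} \<and>
     (\<exists>i\<in>{1..<n}. \<tau> = simple_refl i \<circ> \<sigma> \<and> inv' \<sigma> i < inv' \<sigma> (Suc i))"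
  using perm_length_simple_refl_less_iff(2) by (auto simp: left_cover_def sym_group_carrier)

text \<open>Supplies an upward cover of \<sigma> that stays below \<tau>. A descent i of
  \<open>\<tau> \<circ> inv' \<sigma>\<close> marks two positions that \<sigma> and \<tau> order
  differently; if i + 1 came first in \<sigma>, the inclusion would make \<tau> agree with \<sigma>
  there.\<close>

lemma inversions_psubset_ascent:
  assumes "\<sigma> permutes {1..n}" "\<tau> permutes {1..n}" "inversions n \<sigma> \<subseteq> inversions n \<tau>" "\<sigma> \<noteq> \<tau>"
  obtains i where "i \<in> {1..<n}" "inv' \<sigma> i < inv' \<sigma> (Suc i)"
    "(inv' \<sigma> i, inv' \<sigma> (Suc i)) \<in> inversions n \<tau>"
proof -
  have "\<tau> \<circ> inv' \<sigma> \<noteq> id"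
  proof
    assume "\<tau> \<circ> inv' \<sigma> = id"
    then have "\<tau> (inv' \<sigma> (\<sigma> x)) = \<sigma> x" for x by (metis o_apply id_apply)
    then show False using assms(4) by (simp add: permutes_inverses[OF assms(1)] fun_eq_iff)
  qed
  then obtain i where i: "i \<in> {1..<n}" "\<tau> (inv' \<sigma> (Suc i)) < \<tau> (inv' \<sigma> i)"
    using permutes_exists_descent[OF permutes_compose[OF permutes_inv[OF assms(1)] assms(2)]]
    by auto
  have mem: "inv' \<sigma> i \<in> {1..n}" "inv' \<sigma> (Suc i) \<in> {1..n}"
    using i(1) permutes_in_image[OF permutes_inv[OF assms(1)]] by auto
  have "inv' \<sigma> i < inv' \<sigma> (Suc i)"
  proof (rule ccontr)
    assume "\<not> ?thesis"
    then have "inv' \<sigma> (Suc i) < inv' \<sigma> i"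
      using permutes_inv_neq[OF assms(1), of i "Suc i"] by auto
    then have "(inv' \<sigma> (Suc i), inv' \<sigma> i) \<in> inversions n \<sigma>"
      using mem by (simp add: inversions_def permutes_inverses[OF assms(1)])
    then show False using assms(3) i(2) by (auto simp: inversions_def)
  qed
  with i mem that show thesis by (auto simp: inversions_def)
qed

lemma inversions_eq_imp_eq:
  assumes "\<sigma> permutes {1..n}" "\<tau> permutes {1..n}" "inversions n \<sigma> = inversions n \<tau>"
  shows "\<sigma> = \<tau>"
proof (rule ccontr)
  assume "\<sigma> \<noteq> \<tau>"
  then obtain i where "i \<in> {1..<n}" "inv' \<sigma> i < inv' \<sigma> (Suc i)"
    "(inv' \<sigma> i, inv' \<sigma> (Suc i)) \<in> inversions n \<tau>"
    using inversions_psubset_ascent[OF assms(1,2)] assms(3) by blast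
  then show False
    using inversions_simple_refl(2)[OF assms(1)] assms(3) by auto
qed

text \<open>Every cover adds an inversion. Conversely, \<open>inversions_psubset_ascent\<close>
  builds a chain from \<sigma> up to \<tau>, by induction on the number of inversions of \<tau> that
  \<sigma> lacks.\<close>

lemma weak_le_L_iff:
  assumes "\<sigma> permutes {1..n}"
  shows "weak_le_L n \<sigma> \<tau> \<longleftrightarrow> \<tau> permutes {1..n} \<and> inversions n \<sigma> \<subseteq> inversions n \<tau>"
proof
  assume "weak_le_L n \<sigma> \<tau>"
  then have "(left_cover n)\<^sup>*\<^sup>* \<sigma> \<tau>" by (simp add: weak_le_L_def)
  then show "\<tau> permutes {1..n} \<and> inversions n \<sigma> \<subseteq> inversions n \<tau>"
  proof (induction rule: rtranclp_induct)
    case (step \<tau> \<upsilon>)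
    then obtain i where i: "i \<in> {1..<n}" "inv' \<tau> i < inv' \<tau> (Suc i)"
      and \<upsilon>: "\<upsilon> = simple_refl i \<circ> \<tau>" and \<tau>: "\<tau> permutes {1..n}" by (auto simp: left_cover_iff)
    have "inversions n \<tau> \<subseteq> inversions n \<upsilon>"
      unfolding \<upsilon> inversions_simple_refl(1)[OF \<tau> i] by blast
    then show ?case
      using step.IH simple_refl_comp_permutes[OF \<tau> i(1)] \<upsilon> by blast
  qed (use assms in simp)
next
  assume "\<tau> permutes {1..n} \<and> inversions n \<sigma> \<subseteq> inversions n \<tau>"
  then have "\<tau> permutes {1..n}" "inversions n \<sigma> \<subseteq> inversions n \<tau>" by auto
  with assms have "(left_cover n)\<^sup>*\<^sup>* \<sigma> \<tau>"
  proof (induction "card (inversions n \<tau> - inversions n \<sigma>)" arbitrary: \<sigma> rule: less_induct)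
    case less
    show ?case
    proof (cases "\<sigma> = \<tau>")
      case False
      then obtain i where i: "i \<in> {1..<n}" "inv' \<sigma> i < inv' \<sigma> (Suc i)"
        "(inv' \<sigma> i, inv' \<sigma> (Suc i)) \<in> inversions n \<tau>"
        using inversions_psubset_ascent less.prems by blast
      note aux = inversions_simple_refl[OF less.prems(1) i(1,2)]
      have "(left_cover n)\<^sup>*\<^sup>* (simple_refl i \<circ> \<sigma>) \<tau>"
      proof (rule less.hyps)
        show "card (inversions n \<tau> - inversions n (simple_refl i \<circ> \<sigma>))
            < card (inversions n \<tau> - inversions n \<sigma>)"
          using aux(2) i(3) unfolding aux(1) by (intro psubset_card_mono) auto
        show "simple_refl i \<circ> \<sigma> permutes {1..n}"
          using less.prems(1) i(1) by (rule simple_refl_comp_permutes)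
        show "inversions n (simple_refl i \<circ> \<sigma>) \<subseteq> inversions n \<tau>"
          unfolding aux(1) using i(3) less.prems(3) by blast
      qed (rule less.prems)
      moreover have "left_cover n \<sigma> (simple_refl i \<circ> \<sigma>)"
        unfolding left_cover_iff using i less.prems(1) by blast
      ultimately show ?thesis by (meson converse_rtranclp_into_rtranclp)
    qed simp
  qed
  then show "weak_le_L n \<sigma> \<tau>" by (simp add: weak_le_L_def)
qed

section \<open>The right weak order through inverses\<close>

lemma card_inversions_inv:
  assumes "\<sigma> permutes {1..n}"
  shows "card (inversions n (inv' \<sigma>)) = card (inversions n \<sigma>)"
proof -
  \<comment> \<open>Swapped pairs of values of inversions are inversions of the inverse. Using this
    inequality for \<sigma> and for its inverse gives equality.\<close>
  have *: "card (inversions n \<tau>) \<le> card (inversions n (inv' \<tau>))" if "\<tau> permutes {1..n}" for \<tau>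
  proof (rule card_inj_on_le[where f = "\<lambda>(a, b). (\<tau> b, \<tau> a)"])
    show "inj_on (\<lambda>(a, b). (\<tau> b, \<tau> a)) (inversions n \<tau>)"
      using permutes_inj[OF that] by (auto simp: inj_on_def dest: injD)
    show "(\<lambda>(a, b). (\<tau> b, \<tau> a)) ` inversions n \<tau> \<subseteq> inversions n (inv' \<tau>)"
    proof clarify
      fix a b
      assume "(a, b) \<in> inversions n \<tau>"
      then have ab: "a \<in> {1..n}" "b \<in> {1..n}" "a < b" "\<tau> b < \<tau> a" by (auto simp: inversions_def)
      then have "\<tau> a \<in> {1..n}" "\<tau> b \<in> {1..n}" using permutes_in_image[OF that] by blast+
      with ab show "(\<tau> b, \<tau> a) \<in> inversions n (inv' \<tau>)"
        by (auto simp: inversions_def permutes_inverses[OF that])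
    qed
  qed simp
  show ?thesis
    using *[OF assms] *[OF permutes_inv[OF assms]] by (simp add: permutes_inv_inv[OF assms])
qed

text \<open>Taking inverses turns right multiplication into left multiplication and keeps the
  length.\<close>

lemma right_cover_iff_left_cover_inv:
  assumes "\<sigma> permutes {1..n}" "\<tau> permutes {1..n}"
  shows "right_cover n \<sigma> \<tau> \<longleftrightarrow> left_cover n (inv' \<sigma>) (inv' \<tau>)"
proof -
  have "\<tau> = \<sigma> \<circ> simple_refl i \<longleftrightarrow> inv' \<tau> = simple_refl i \<circ> inv' \<sigma>" if "i \<in> {1..<n}" for i
  proof -
    have "inv' (\<sigma> \<circ> simple_refl i) = simple_refl i \<circ> inv' \<sigma>"
      using permutes_bij[OF assms(1)] by (simp add: o_inv_distrib)
    then show ?thesis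
      using assms simple_refl_permutes[OF that]
      by (metis permutes_compose permutes_inv_inv)
  qed
  moreover have "perm_length n (inv' \<sigma>) = perm_length n \<sigma>" if "\<sigma> permutes {1..n}" for \<sigma>
    using that permutes_inv[OF that]
    by (simp only: perm_length_eq_card_inversions card_inversions_inv)
  ultimately show ?thesis
    unfolding right_cover_def left_cover_def sym_group_carrier
    using assms permutes_inv[OF assms(1)] by metis
qed

lemma right_cover_permutes:
  assumes "right_cover n \<sigma> \<tau>"
  shows "\<sigma> permutes {1..n}" "\<tau> permutes {1..n}"
  using assms permutes_compose[OF simple_refl_permutes]
  by (auto simp: right_cover_def sym_group_carrier)

lemma weak_le_R_iff:
  assumes "\<sigma> permutes {1..n}" "\<tau> permutes {1..n}"
  shows "weak_le_R n \<sigma> \<tau> \<longleftrightarrow> inversions n (inv' \<sigma>) \<subseteq> inversions n (inv' \<tau>)"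
proof -
  have "weak_le_R n \<sigma> \<tau> \<longleftrightarrow> weak_le_L n (inv' \<sigma>) (inv' \<tau>)"
  proof
    assume "weak_le_R n \<sigma> \<tau>"
    then have "(right_cover n)\<^sup>*\<^sup>* \<sigma> \<tau>" by (simp add: weak_le_R_def)
    then have "(left_cover n)\<^sup>*\<^sup>* (inv' \<sigma>) (inv' \<tau>)"
    proof (induction rule: rtranclp_induct)
      case (step \<tau> \<upsilon>)
      then show ?case
        using right_cover_iff_left_cover_inv right_cover_permutes
        by (meson rtranclp.rtrancl_into_rtrancl)
    qed simp
    then show "weak_le_L n (inv' \<sigma>) (inv' \<tau>)" by (simp add: weak_le_L_def)
  next
    assume "weak_le_L n (inv' \<sigma>) (inv' \<tau>)"
    then have "(left_cover n)\<^sup>*\<^sup>* (inv' \<sigma>) (inv' \<tau>)" by (simp add: weak_le_L_def)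
    \<comment> \<open>Being a permutation is carried along the chain, so that double inverses cancel
      when a cover is transported back.\<close>
    then have "inv' \<tau> permutes {1..n} \<and> (right_cover n)\<^sup>*\<^sup>* \<sigma> (inv' (inv' \<tau>))"
    proof (induction rule: rtranclp_induct)
      case base
      then show ?case using assms permutes_inv by (simp add: permutes_inv_inv)
    next
      case (step x y)
      then have y: "y permutes {1..n}"
        using simple_refl_comp_permutes by (auto simp: left_cover_iff)
      from step.IH have x: "x permutes {1..n}" ..
      have "right_cover n (inv' x) (inv' y)"
        using step.hyps(2) right_cover_iff_left_cover_inv[OF permutes_inv[OF x] permutes_inv[OF y]]
        by (simp only: permutes_inv_inv[OF x] permutes_inv_inv[OF y])
      with y step show ?case by (meson rtranclp.rtrancl_into_rtrancl)
    qed
    then show "weak_le_R n \<sigma> \<tau>"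
      using assms by (simp add: weak_le_R_def permutes_inv_inv)
  qed
  then show ?thesis
    unfolding weak_le_L_iff[OF permutes_inv[OF assms(1)]] using permutes_inv[OF assms(2)] by blast
qed

text \<open>Inversion sets determine permutations, so every other element of G has strictly fewer
  inversions than w.\<close>

lemma longest_element_eq:
  assumes "w \<in> G" "\<And>v. v \<in> G \<Longrightarrow> v permutes {1..n}"
    and sub: "\<And>v. v \<in> G \<Longrightarrow> inversions n v \<subseteq> inversions n w"
  shows "longest_element n G = w"
  unfolding longest_element_def
proof (rule the_equality)
  have less: "perm_length n v < perm_length n w" if "v \<in> G" "v \<noteq> w" for v
    using sub[OF that(1)] inversions_eq_imp_eq[of v n w] assms(1,2) that
    by (auto simp: perm_length_eq_card_inversions intro!: psubset_card_mono)
  then show "w \<in> G \<and> (\<forall>v\<in>G. v \<noteq> w \<longrightarrow> perm_length n v < perm_length n w)"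
    using assms(1) by blast
  fix u
  assume "u \<in> G \<and> (\<forall>v\<in>G. v \<noteq> u \<longrightarrow> perm_length n v < perm_length n u)"
  then show "u = w" using assms(1) less by (metis less_asym)
qed

subsection \<open>The longest element\<close>

text \<open>Extended by the identity outside [n] so that it lies in the carrier; it turns out to be
  \<open>w0 n\<close>.\<close>

definition reversal :: "nat \<Rightarrow> nat \<Rightarrow> nat" where
  "reversal n i = (if i \<in> {1..n} then Suc n - i else i)"

lemma reversal_reversal [simp]: "reversal n (reversal n i) = i"
  by (auto simp: reversal_def)

lemma reversal_eq_iff: "reversal n i = reversal n j \<longleftrightarrow> i = j"
  by (metis reversal_reversal)

lemma reversal_comp_reversal [simp]: "reversal n \<circ> reversal n = id"
  by (simp add: fun_eq_iff)

lemma reversal_mem [simp]: "reversal n i \<in> {1..n} \<longleftrightarrow> i \<in> {1..n}"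
  by (auto simp: reversal_def)

lemma reversal_permutes: "reversal n permutes {1..n}"
  by (rule bij_imp_permutes)
    (auto simp: reversal_def intro!: bij_betwI[where g = "reversal n"])

lemma reversal_less_iff:
  assumes "i \<in> {1..n}" "j \<in> {1..n}"
  shows "reversal n i < reversal n j \<longleftrightarrow> j < i"
  using assms by (auto simp: reversal_def)

lemma w0_eq_reversal: "w0 n = reversal n"
  unfolding w0_def
proof (rule longest_element_eq)
  fix v
  show "inversions n v \<subseteq> inversions n (reversal n)"
    by (auto simp: inversions_def reversal_def)
qed (simp_all only: sym_group_carrier reversal_permutes)

text \<open>Reading backwards flips each pair of positions, which complements the inversions up to
  relabelling.\<close>

lemma inversions_comp_reversal:
  assumes "\<sigma> permutes {1..n}"
  shows "(a, b) \<in> inversions n (\<sigma> \<circ> reversal n) \<longleftrightarrow>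
    1 \<le> a \<and> a < b \<and> b \<le> n \<and> (reversal n b, reversal n a) \<notin> inversions n \<sigma>"
proof (cases "1 \<le> a \<and> a < b \<and> b \<le> n")
  case True
  then have *: "a \<in> {1..n}" "b \<in> {1..n}" by auto
  have "\<sigma> (reversal n a) \<noteq> \<sigma> (reversal n b)"
    using permutes_inj[OF assms] True by (metis injD less_irrefl reversal_reversal)
  moreover have "reversal n a \<in> {1..n}" "reversal n b \<in> {1..n}" unfolding reversal_mem using * .
  ultimately show ?thesis
    using True reversal_less_iff[OF *(2,1)] by (auto simp: inversions_def)
qed (auto simp: inversions_def)

lemma inversions_comp_reversal_subset_iff:
  assumes "\<sigma> permutes {1..n}" "\<tau> permutes {1..n}"
  shows "inversions n (\<sigma> \<circ> reversal n) \<subseteq> inversions n (\<tau> \<circ> reversal n) \<longleftrightarrow>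
    inversions n \<tau> \<subseteq> inversions n \<sigma>"
proof -
  have *: "inversions n (\<sigma> \<circ> reversal n) \<subseteq> inversions n (\<tau> \<circ> reversal n)"
    if "inversions n \<tau> \<subseteq> inversions n \<sigma>" "\<sigma> permutes {1..n}" "\<tau> permutes {1..n}" for \<sigma> \<tau>
  proof clarify
    fix a b
    assume "(a, b) \<in> inversions n (\<sigma> \<circ> reversal n)"
    then show "(a, b) \<in> inversions n (\<tau> \<circ> reversal n)"
      using that(1) by (auto simp: inversions_comp_reversal[OF that(2)] inversions_comp_reversal[OF that(3)])
  qed
  have "\<upsilon> \<circ> reversal n permutes {1..n}" if "\<upsilon> permutes {1..n}" for \<upsilon>
    using that reversal_permutes by (rule permutes_compose[rotated])
  \<comment> \<open>The converse is the same implication for the reversed permutations, as reversing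
    twice is the identity.\<close>
  from *[OF _ this[OF assms(2)] this[OF assms(1)]] *[OF _ assms] show ?thesis
    unfolding comp_assoc reversal_comp_reversal comp_id by blast
qed

section \<open>The map sending \<gamma> to w0 \<gamma>^-1\<close>

lemma inv_reversal: "inv' (reversal n) = reversal n"
  by (rule inv_equality) auto

text \<open>The right weak order and \<open>Sigma_R\<close> both inspect a permutation through its
  inverse, which here is \<gamma> read backwards.\<close>

lemma inv_reversal_comp_inv:
  assumes "\<gamma> permutes {1..n}"
  shows "inv' (reversal n \<circ> inv' \<gamma>) = \<gamma> \<circ> reversal n"
  using permutes_bij[OF permutes_inv[OF assms]] permutes_bij[OF reversal_permutes]
  by (simp only: o_inv_distrib inv_reversal permutes_inv_inv[OF assms])

lemma reversal_comp_inv_permutes: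
  assumes "\<gamma> permutes {1..n}"
  shows "reversal n \<circ> inv' \<gamma> permutes {1..n}"
  using permutes_compose[OF permutes_inv[OF assms] reversal_permutes] .

lemma reversal_comp_inv_surj:
  assumes "\<tau> permutes {1..n}"
  obtains \<gamma> where "\<tau> = reversal n \<circ> inv' \<gamma>" "\<gamma> permutes {1..n}"
proof
  show "inv' \<tau> \<circ> reversal n permutes {1..n}"
    using permutes_compose[OF reversal_permutes permutes_inv[OF assms]] .
  show "\<tau> = reversal n \<circ> inv' (inv' \<tau> \<circ> reversal n)"
    using permutes_bij[OF permutes_inv[OF assms]] permutes_bij[OF reversal_permutes]
    by (simp add: o_inv_distrib inv_reversal permutes_inv_inv[OF assms] comp_assoc[symmetric])
qed

text \<open>The right order compares the inversions of inverses, here of \<gamma> read backwards,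
  and reading backwards complements inversions. So the map reverses the order and the end points
  change places.\<close>

lemma interval_L_reversal:
  assumes "\<sigma> permutes {1..n}" "\<rho> permutes {1..n}"
  shows "{w0 n \<circ> inv' \<gamma> | \<gamma>. \<gamma> \<in> interval_L n \<sigma> \<rho>} = interval_R n (w0 n \<circ> inv' \<rho>) (w0 n \<circ> inv' \<sigma>)"
proof -
  note perm = reversal_comp_inv_permutes
  have mem: "reversal n \<circ> inv' \<gamma> \<in> interval_R n (reversal n \<circ> inv' \<rho>) (reversal n \<circ> inv' \<sigma>)
      \<longleftrightarrow> \<gamma> \<in> interval_L n \<sigma> \<rho>" if "\<gamma> permutes {1..n}" for \<gamma>
    unfolding interval_R_def interval_L_def sym_group_carrier mem_Collect_eq
      weak_le_R_iff[OF perm[OF assms(2)] perm[OF that]]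
      weak_le_R_iff[OF perm[OF that] perm[OF assms(1)]]
      weak_le_L_iff[OF assms(1)] weak_le_L_iff[OF that]
      inv_reversal_comp_inv[OF assms(1)] inv_reversal_comp_inv[OF assms(2)]
      inv_reversal_comp_inv[OF that]
      inversions_comp_reversal_subset_iff[OF that assms(1)]
      inversions_comp_reversal_subset_iff[OF assms(2) that]
    using assms perm[OF that] that by blast
  show ?thesis
    unfolding w0_eq_reversal
  proof (intro Set.equalityI subsetI)
    fix \<tau>
    assume "\<tau> \<in> {reversal n \<circ> inv' \<gamma> | \<gamma>. \<gamma> \<in> interval_L n \<sigma> \<rho>}"
    then obtain \<gamma> where "\<tau> = reversal n \<circ> inv' \<gamma>" "\<gamma> \<in> interval_L n \<sigma> \<rho>" by blast
    then show "\<tau> \<in> interval_R n (reversal n \<circ> inv' \<rho>) (reversal n \<circ> inv' \<sigma>)"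
      using mem[of \<gamma>] unfolding interval_L_def sym_group_carrier by blast
  next
    fix \<tau>
    assume \<tau>: "\<tau> \<in> interval_R n (reversal n \<circ> inv' \<rho>) (reversal n \<circ> inv' \<sigma>)"
    then obtain \<gamma> where "\<tau> = reversal n \<circ> inv' \<gamma>" "\<gamma> permutes {1..n}"
      using reversal_comp_inv_surj[of \<tau>] unfolding interval_R_def sym_group_carrier by blast
    then show "\<tau> \<in> {reversal n \<circ> inv' \<gamma> | \<gamma>. \<gamma> \<in> interval_L n \<sigma> \<rho>}"
      using mem[of \<gamma>] \<tau> by blast
  qed
qed

subsection \<open>Longest elements of parabolic subgroups\<close>

text \<open>The reflection at i moves points across the boundary after k only if i = k. Both
  properties pass to products, and a generator is its own inverse.\<close>

lemma generate_simple_refl: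
  assumes "S \<subseteq> {1..<n}" and "v \<in> generate (sym_group n) (simple_refl ` S)"
  shows "v permutes {1..n}" and "k \<in> {1..<n} - S \<Longrightarrow> v ` {1..k} = {1..k}"
proof -
  have refl: "simple_refl i permutes {1..n} \<and> (\<forall>k\<in>{1..<n} - S. simple_refl i ` {1..k} = {1..k})"
    if "i \<in> S" for i
  proof (intro conjI ballI)
    show "simple_refl i permutes {1..n}"
      using that assms(1) by (intro simple_refl_permutes) blast
    fix k
    assume "k \<in> {1..<n} - S"
    with that have "k \<noteq> i" by blast
    show "simple_refl i ` {1..k} = {1..k}"
      using \<open>k \<noteq> i\<close> that assms(1) by (intro transpose_image_eq) auto
  qed
  have "v permutes {1..n} \<and> (\<forall>k\<in>{1..<n} - S. v ` {1..k} = {1..k})"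
    using assms(2)
  proof (induction rule: generate.induct)
    case one
    then show ?case using permutes_id[of "{1..n}"] by (simp add: sym_group_def id_def)
  next
    case (incl h)
    then show ?case using refl by blast
  next
    case (inv h)
    then obtain i where i: "i \<in> S" "h = simple_refl i" by blast
    with refl have "h \<in> carrier (sym_group n)" by (simp only: sym_group_carrier)
    then have "inv\<^bsub>sym_group n\<^esub> h = simple_refl i"
      using i by (simp add: sym_group_inv_equality)
    then show ?case using refl[OF i(1)] by simp
  next
    case (eng g h)
    then have "g \<otimes>\<^bsub>sym_group n\<^esub> h permutes {1..n}"
      unfolding sym_group_mult by (intro permutes_compose) (rule conjunct1, assumption)+
    moreover have "(g \<otimes>\<^bsub>sym_group n\<^esub> h) ` {1..k} = {1..k}" if "k \<in> {1..<n} - S" for k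
      using eng.IH that unfolding sym_group_mult image_comp[symmetric] by metis
    ultimately show ?case by blast
  qed
  then show "v permutes {1..n}" and "k \<in> {1..<n} - S \<Longrightarrow> v ` {1..k} = {1..k}" by blast+
qed

text \<open>The pairs inside one block when [n] is cut after every k in [n-1] outside S.\<close>

definition block_pairs :: "nat \<Rightarrow> nat set \<Rightarrow> (nat \<times> nat) set" where
  "block_pairs n S = {(a, b). 1 \<le> a \<and> a < b \<and> b \<le> n \<and> {a..<b} \<subseteq> S}"

lemma permutes_image_atMost_iff:
  assumes "\<sigma> permutes {1..n}" "\<sigma> ` {1..k} = {1..k}" "a \<in> {1..n}"
  shows "\<sigma> a \<le> k \<longleftrightarrow> a \<le> k"
proof -
  have "\<sigma> a \<in> {1..n}" using assms(1,3) permutes_in_image by metis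
  moreover have "\<sigma> a \<in> {1..k} \<longleftrightarrow> a \<in> {1..k}"
    using assms(2) inj_image_mem_iff[OF permutes_inj[OF assms(1)]] by metis
  ultimately show ?thesis using assms(3) by auto
qed

text \<open>The subgroup preserves \<open>{1..k}\<close> for every cut k, so positions on different
  sides of a cut keep their values on those sides.\<close>

lemma inversions_generate_subset:
  assumes "S \<subseteq> {1..<n}" and "v \<in> generate (sym_group n) (simple_refl ` S)"
  shows "inversions n v \<subseteq> block_pairs n S"
proof clarify
  fix a b
  assume "(a, b) \<in> inversions n v"
  then have ab: "1 \<le> a" "a < b" "b \<le> n" "v b < v a" by (auto simp: inversions_def)
  have "k \<in> S" if k: "a \<le> k" "k < b" for k
  proof (rule ccontr)
    assume "k \<notin> S"
    then have "v ` {1..k} = {1..k}"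
      using generate_simple_refl(2)[OF assms] k ab by auto
    from permutes_image_atMost_iff[OF generate_simple_refl(1)[OF assms] this]
    have "v a \<le> k" "\<not> v b \<le> k" using ab k by auto
    with ab(4) show False by simp
  qed
  with ab show "(a, b) \<in> block_pairs n S" by (auto simp: block_pairs_def)
qed

text \<open>An element w with the most inversions is shown to invert every pair inside a block. By
  \<open>inversions_generate_subset\<close> it then dominates the subgroup.\<close>

lemma longest_generate:
  assumes S: "S \<subseteq> {1..<n}"
  defines "G \<equiv> generate (sym_group n) (simple_refl ` S)"
  shows "longest_element n G permutes {1..n}"
    and "inversions n (longest_element n G) = block_pairs n S"
proof -
  have perm: "v permutes {1..n}" if "v \<in> G" for v
    using generate_simple_refl(1)[OF S] that by (simp add: G_def)
  have fin: "finite G"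
    using finite_subset[OF _ finite_permutations[OF finite_atLeastAtMost, of 1 n], of G] perm
    by blast
  have "id \<in> G"
    using generate.one[of "sym_group n"] by (simp add: G_def sym_group_def)
  then have "G \<noteq> {}" by blast
  with fin obtain w where w: "w \<in> G" and "card (inversions n w) = Max ((\<lambda>v. card (inversions n v)) ` G)"
    by (rule obtains_MAX[where f = "\<lambda>v. card (inversions n v)"]) metis
  then have max: "card (inversions n v) \<le> card (inversions n w)" if "v \<in> G" for v
    using fin that by simp
  note w_perm = perm[OF w]
  \<comment> \<open>Otherwise \<open>simple_refl i \<circ> w\<close> would be an element with one
    more inversion.\<close>
  have step: "inv' w (Suc i) < inv' w i" if "i \<in> S" for i
  proof (rule ccontr)
    assume "\<not> ?thesis"
    then have "inv' w i < inv' w (Suc i)"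
      using permutes_inv_neq[OF w_perm, of i "Suc i"] by simp
    moreover have "i \<in> {1..<n}" using that S by blast
    ultimately have "card (inversions n (simple_refl i \<circ> w)) = Suc (card (inversions n w))"
      using card_inversions_ascent[OF w_perm] by blast
    moreover have "simple_refl i \<circ> w \<in> G"
      using generate.eng[OF generate.incl w[unfolded G_def], of "simple_refl i"] that
      by (simp add: G_def sym_group_mult)
    ultimately show False using max[of "simple_refl i \<circ> w"] by linarith
  qed
  have dec: "{c..<d} \<subseteq> S \<Longrightarrow> inv' w d < inv' w c" if "c < d" for c d
    using that
  proof (induction rule: less_Suc_induct)
    case (1 i)
    then show ?case using step by simp
  next
    case (2 i j k)
    then have "{i..<j} \<subseteq> {i..<k}" "{j..<k} \<subseteq> {i..<k}" by auto
    with 2 show ?case by (meson less_trans order_trans)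
  qed
  have "block_pairs n S \<subseteq> inversions n w"
  proof clarify
    fix a b
    assume "(a, b) \<in> block_pairs n S"
    then have ab: "1 \<le> a" "a < b" "b \<le> n" "{a..<b} \<subseteq> S" by (auto simp: block_pairs_def)
    have "w b < w a"
    proof (rule ccontr)
      assume "\<not> ?thesis"
      then have less: "w a < w b"
        using ab(2) permutes_inj[OF w_perm] by (metis injD linorder_neqE_nat less_irrefl)
      have mem: "w a \<in> {1..n}" "w b \<in> {1..n}"
        using ab permutes_in_image[OF w_perm, of a] permutes_in_image[OF w_perm, of b] by auto
      \<comment> \<open>A cut between the two values would, since w preserves the initial segment
        ending there, also separate a from b. So \<open>dec\<close> applies to the values.\<close>
      have "{w a..<w b} \<subseteq> S"
      proof
        fix k
        assume k: "k \<in> {w a..<w b}"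
        show "k \<in> S"
        proof (rule ccontr)
          assume "k \<notin> S"
          then have "w ` {1..k} = {1..k}"
            using generate_simple_refl(2)[OF S] w k mem by (auto simp: G_def)
          from permutes_image_atMost_iff[OF w_perm this, of a]
            permutes_image_atMost_iff[OF w_perm this, of b]
          have "k \<in> {a..<b}" using ab k by auto
          with ab(4) \<open>k \<notin> S\<close> show False by blast
        qed
      qed
      from dec[OF less this] ab(2) show False
        by (simp add: permutes_inverses[OF w_perm])
    qed
    with ab show "(a, b) \<in> inversions n w" by (auto simp: inversions_def)
  qed
  with inversions_generate_subset[OF S] w
  have inv_w: "inversions n w = block_pairs n S" unfolding G_def by blast
  have "longest_element n G = w"
    using w perm inversions_generate_subset[OF S] unfolding inv_w[symmetric] G_def[symmetric]
    by (rule longest_element_eq)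
  with inv_w w_perm show "longest_element n G permutes {1..n}"
    and "inversions n (longest_element n G) = block_pairs n S" by simp_all
qed

subsection \<open>Compositions and subsets\<close>

lemma composition_of_Nil [simp]: "composition_of n [] \<longleftrightarrow> n = 0"
  by (auto simp: composition_of_def)

lemma composition_of_Cons [simp]:
  "composition_of n (a # \<alpha>) \<longleftrightarrow> 0 < a \<and> a \<le> n \<and> composition_of (n - a) \<alpha>"
  by (auto simp: composition_of_def)

lemma comp_set_Nil [simp]: "comp_set [] = {}"
  by (simp add: comp_set_def)

lemma comp_set_eq_image: "comp_set \<alpha> = (\<lambda>i. sum_list (take i \<alpha>)) ` {1..<length \<alpha>}"
  by (auto simp: comp_set_def image_iff)

text \<open>The new element a comes from the empty partial sum of \<alpha>. If \<alpha> is empty, a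
  is the full sum, which \<open>comp_set\<close> omits.\<close>

lemma comp_set_Cons:
  "comp_set (a # \<alpha>) = (if \<alpha> = [] then {} else insert a ((+) a ` comp_set \<alpha>))"
proof -
  have "comp_set (a # \<alpha>) = (\<lambda>i. a + sum_list (take i \<alpha>)) ` {..<length \<alpha>}"
  proof (intro Set.equalityI subsetI)
    fix x
    assume "x \<in> comp_set (a # \<alpha>)"
    then obtain i where "1 \<le> i" "i < Suc (length \<alpha>)" "x = sum_list (take i (a # \<alpha>))"
      by (auto simp: comp_set_def)
    then show "x \<in> (\<lambda>i. a + sum_list (take i \<alpha>)) ` {..<length \<alpha>}"
      by (cases i) auto
  next
    fix x
    assume "x \<in> (\<lambda>i. a + sum_list (take i \<alpha>)) ` {..<length \<alpha>}"
    then obtain i where "i < length \<alpha>" "x = sum_list (take (Suc i) (a # \<alpha>))" by auto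
    then show "x \<in> comp_set (a # \<alpha>)"
      unfolding comp_set_def by (auto intro!: exI[of _ "Suc i"])
  qed
  also have "{..<length \<alpha>} = (if \<alpha> = [] then {} else insert 0 {1..<length \<alpha>})" by auto
  also have "(\<lambda>i. a + sum_list (take i \<alpha>)) ` \<dots> =
      (if \<alpha> = [] then {} else insert a ((\<lambda>i. a + sum_list (take i \<alpha>)) ` {1..<length \<alpha>}))"
    by simp
  also have "(\<lambda>i. a + sum_list (take i \<alpha>)) ` {1..<length \<alpha>} = (+) a ` comp_set \<alpha>"
    by (simp add: comp_set_eq_image image_image)
  finally show ?thesis by simp
qed

lemma comp_set_subset:
  "composition_of n \<alpha> \<Longrightarrow> comp_set \<alpha> \<subseteq> {1..<n}"
proof (induction \<alpha> arbitrary: n)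
  case (Cons a \<alpha>)
  then have "comp_set \<alpha> \<subseteq> {1..<n - a}" by simp
  moreover have "a < n" if "\<alpha> \<noteq> []"
    using Cons.prems that by (cases \<alpha>) auto
  moreover have "0 < a" using Cons.prems by simp
  ultimately show ?case unfolding comp_set_Cons by (fastforce split: if_splits)
qed simp

text \<open>The least cut is the first part; the other cuts, shifted down by it, come from a
  composition of the rest.\<close>

lemma comp_set_exists:
  "Z \<subseteq> {1..<n} \<Longrightarrow> \<exists>\<alpha>. composition_of n \<alpha> \<and> comp_set \<alpha> = Z"
proof (induction n arbitrary: Z rule: less_induct)
  case (less n)
  show ?case
  proof (cases "Z = {}")
    case True
    then show ?thesis
      by (intro exI[of _ "if n = 0 then [] else [n]"]) (simp add: comp_set_Cons)
  next
    case False
    define a where "a = Min Z"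
    have fin: "finite Z" using less.prems finite_subset by blast
    have a: "a \<in> Z" "\<And>z. z \<in> Z \<Longrightarrow> a \<le> z" using False fin by (auto simp: a_def)
    then have an: "1 \<le> a" "a < n" using less.prems by auto
    have "(\<lambda>z. z - a) ` (Z - {a}) \<subseteq> {1..<n - a}"
    proof
      fix x
      assume "x \<in> (\<lambda>z. z - a) ` (Z - {a})"
      then obtain z where z: "z \<in> Z" "z \<noteq> a" "x = z - a" by blast
      then have "a < z" "z < n" using a(2)[of z] less.prems by auto
      with z show "x \<in> {1..<n - a}" by auto
    qed
    from less.IH[OF _ this] an obtain \<alpha> where
      \<alpha>: "composition_of (n - a) \<alpha>" "comp_set \<alpha> = (\<lambda>z. z - a) ` (Z - {a})" by auto
    from \<alpha>(1) an have "\<alpha> \<noteq> []" by auto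
    moreover have "insert a ((+) a ` (\<lambda>z. z - a) ` (Z - {a})) = Z"
      using a by (force simp: image_image image_iff)
    ultimately have "comp_set (a # \<alpha>) = Z" by (simp add: comp_set_Cons \<alpha>(2))
    moreover have "composition_of n (a # \<alpha>)" using \<alpha> an by simp
    ultimately show ?thesis by blast
  qed
qed

lemma comp_set_inject:
  "composition_of n \<alpha> \<Longrightarrow> composition_of n \<beta> \<Longrightarrow> comp_set \<alpha> = comp_set \<beta> \<Longrightarrow> \<alpha> = \<beta>"
proof (induction \<alpha> arbitrary: n \<beta>)
  case Nil
  then show ?case by (cases \<beta>) auto
next
  case (Cons a \<alpha>)
  then obtain b \<beta>' where \<beta>: "\<beta> = b # \<beta>'" by (cases \<beta>) auto
  show ?case
  proof (cases "\<alpha> = []")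
    case True
    with Cons.prems(3) have "\<beta>' = []" by (simp add: \<beta> comp_set_Cons split: if_splits)
    with True show ?thesis using Cons.prems \<beta> by simp
  next
    case False
    then have "\<beta>' \<noteq> []" and eq: "insert a ((+) a ` comp_set \<alpha>) = insert b ((+) b ` comp_set \<beta>')"
      using Cons.prems(3) unfolding \<beta> comp_set_Cons by (simp_all split: if_splits)
    have "comp_set \<alpha> \<subseteq> {1..<n - a}" "comp_set \<beta>' \<subseteq> {1..<n - b}"
      using Cons.prems(1,2) \<beta> by (simp_all only: comp_set_subset composition_of_Cons)
    then have pos: "a \<notin> (+) a ` comp_set \<alpha>" "b \<notin> (+) b ` comp_set \<beta>'" by auto
    \<comment> \<open>Each first part lies in the other set, whose least element is the other first
      part.\<close>
    have "a \<in> insert b ((+) b ` comp_set \<beta>')" "b \<in> insert a ((+) a ` comp_set \<alpha>)"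
      unfolding eq[symmetric] by (rule insertI1) (unfold eq, rule insertI1)
    then have "b \<le> a" "a \<le> b" by auto
    then have "a = b" by simp
    have "(+) a ` comp_set \<alpha> = (+) a ` comp_set \<beta>'"
      using eq pos unfolding \<open>a = b\<close> by (rule insert_ident[THEN iffD1, rotated 2])
    then have "comp_set \<alpha> = comp_set \<beta>'" by (simp add: inj_image_eq_iff)
    moreover have "composition_of (n - a) \<alpha>" "composition_of (n - a) \<beta>'"
      using Cons.prems(1,2) \<beta> \<open>a = b\<close> by simp_all
    ultimately show ?thesis
      using Cons.IH \<beta> \<open>a = b\<close> by blast
  qed
qed

text \<open>Existence and uniqueness of the composition give the \<open>THE\<close> in
  \<open>comp_compl\<close> its meaning.\<close>

lemma comp_set_comp_compl: "comp_set (comp_compl n \<alpha>) = {1..<n} - comp_set \<alpha>"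
proof -
  have "\<exists>!\<beta>. composition_of n \<beta> \<and> comp_set \<beta> = {1..<n} - comp_set \<alpha>"
    using comp_set_exists[of "{1..<n} - comp_set \<alpha>" n] comp_set_inject[of n] by auto
  from theI'[OF this] show ?thesis by (simp add: comp_compl_def)
qed

subsection \<open>Blocks between cut points\<close>

text \<open>The number, counted from 1, of the block containing c. The comparison is strict because
  a cut point is the last element of its block.\<close>

definition block_index :: "nat set \<Rightarrow> nat \<Rightarrow> nat" where
  "block_index Z c = Suc (card {z \<in> Z. z < c})"

lemma block_index_mono:
  assumes "finite Z" "c \<le> d"
  shows "block_index Z c \<le> block_index Z d"
  using assms unfolding block_index_def by (auto intro!: card_mono)

lemma block_index_eq_imp:
  assumes "finite Z" "c \<le> d" "block_index Z c = block_index Z d"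
  shows "Z \<inter> {c..<d} = {}"
proof -
  have "{z \<in> Z. z < c} = {z \<in> Z. z < d}"
    using assms unfolding block_index_def by (intro card_subset_eq) auto
  then show ?thesis unfolding set_eq_iff by (auto simp: not_less[symmetric])
qed

text \<open>Ties the intervals of the algorithm to a count: the cuts below a point of the k-th
  interval are exactly the first k - 1, and the intervals exhaust [n].\<close>

lemma block_eq:
  assumes Z: "Z \<subseteq> {1..<n}" and j: "j \<in> {1..card Z + 1}"
  shows "{cuts n Z ! (j - 1) + 1..cuts n Z ! j} = {c \<in> {1..n}. block_index Z c = j}"
\<comment> \<open>For n = 0 the list of cuts is \<open>[0, 0]\<close>, which does not increase
  strictly.\<close>
proof (cases "n = 0")
  case True
  with Z have "Z = {}" by simp
  with j True show ?thesis by (simp add: cuts_def)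
next
  case False
  define xs where "xs = cuts n Z"
  have fin: "finite Z" using Z finite_subset by blast
  have len: "length xs = card Z + 2" by (simp add: xs_def cuts_def)
  have set_xs: "set xs = insert 0 (insert n Z)" using fin by (auto simp: xs_def cuts_def)
  have "sorted_wrt (<) xs"
    using Z False fin by (auto simp: xs_def cuts_def sorted_wrt_append)
  then have less: "xs ! i < xs ! k" if "i < k" "k < card Z + 2" for i k
    using that sorted_wrt_nth_less len by metis
  have first: "xs ! 0 = 0" by (simp add: xs_def cuts_def)
  have last: "xs ! (card Z + 1) = n" by (simp add: xs_def cuts_def nth_append)
  have Z_eq: "Z = (!) xs ` {1..card Z}"
  proof -
    have "Z = (!) (sorted_list_of_set Z) ` {0..<card Z}"
      using nth_image[of "card Z" "sorted_list_of_set Z"] fin by simp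
    also have "\<dots> = (\<lambda>i. xs ! Suc i) ` {0..<card Z}"
      by (rule image_cong) (auto simp: xs_def cuts_def nth_append)
    also have "\<dots> = (!) xs ` Suc ` {0..<card Z}" unfolding image_image ..
    also have "Suc ` {0..<card Z} = {1..card Z}" by (simp add: atLeastLessThanSuc_atLeastAtMost)
    finally show ?thesis .
  qed
  have index: "block_index Z c = k"
    if k: "k \<in> {1..card Z + 1}" and c: "xs ! (k - 1) < c" "c \<le> xs ! k" for c k
  proof -
    have "xs ! i < c \<longleftrightarrow> i < k" if "i \<in> {1..card Z}" for i
    proof (cases "i < k")
      case True
      then have "i = k - 1 \<or> i < k - 1" by auto
      then have "xs ! i \<le> xs ! (k - 1)" using less[of i "k - 1"] k by fastforce
      with True c(1) show ?thesis by simp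
    next
      case False
      then have "i = k \<or> k < i" by auto
      then have "xs ! k \<le> xs ! i" using less[of k i] that by fastforce
      with False c(2) show ?thesis by simp
    qed
    then have "{z \<in> Z. z < c} = (!) xs ` {1..<k}"
      using k by (subst Z_eq) auto
    moreover have "inj_on ((!) xs) {1..<k}"
      using less k by (intro strict_mono_on_imp_inj_on strict_mono_onI) auto
    ultimately show ?thesis using k by (simp add: block_index_def card_image)
  qed
  have le_n: "xs ! k \<le> n" if "k < card Z + 2" for k
    using less[of k "card Z + 1"] last that by (cases "k = card Z + 1") auto
  have ex: "\<exists>k\<in>{1..card Z + 1}. xs ! (k - 1) < c \<and> c \<le> xs ! k" if "c \<in> {1..n}" for c
  proof -
    \<comment> \<open>The first entry not below c is the right end of its interval.\<close>
    define k where "k = (LEAST k. c \<le> xs ! k)"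
    have k: "c \<le> xs ! k" unfolding k_def by (rule LeastI[of _ "card Z + 1"]) (use that last in simp)
    have "k \<le> card Z + 1" unfolding k_def by (rule Least_le) (use that last in simp)
    moreover have "k \<noteq> 0" using k that first by (cases "k = 0") auto
    moreover from this have "\<not> c \<le> xs ! (k - 1)"
      unfolding k_def by (intro not_less_Least[of _ "\<lambda>k. c \<le> xs ! k"]) simp
    ultimately show ?thesis using k by (intro bexI[of _ k]) auto
  qed
  show ?thesis
    unfolding xs_def[symmetric]
  proof (intro Set.equalityI subsetI)
    fix c
    assume "c \<in> {xs ! (j - 1) + 1..xs ! j}"
    then show "c \<in> {c \<in> {1..n}. block_index Z c = j}"
      using index[OF j, of c] le_n[of j] j by auto
  next
    fix c
    assume "c \<in> {c \<in> {1..n}. block_index Z c = j}"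
    then show "c \<in> {xs ! (j - 1) + 1..xs ! j}"
      using ex[of c] index by fastforce
  qed
qed

text \<open>The cuts increase strictly, so each block contains its own right end.\<close>

lemma block_index_image:
  assumes Z: "Z \<subseteq> {1..<n}" and "n \<noteq> 0"
  shows "block_index Z ` {1..n} = {1..card Z + 1}"
proof (intro Set.equalityI subsetI)
  fix j
  have fin: "finite Z" using Z finite_subset by blast
  {
    assume "j \<in> block_index Z ` {1..n}"
    then show "j \<in> {1..card Z + 1}"
      using fin by (auto simp: block_index_def intro!: card_mono)
  }
  assume j: "j \<in> {1..card Z + 1}"
  have len: "length (cuts n Z) = card Z + 2" by (simp add: cuts_def)
  have "sorted_wrt (<) (cuts n Z)"
    using Z \<open>n \<noteq> 0\<close> fin by (auto simp: cuts_def sorted_wrt_append)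
  then have "cuts n Z ! (j - 1) < cuts n Z ! j"
    using len j by (auto dest: sorted_wrt_nth_less[where i = "j - 1" and j = j])
  then have "cuts n Z ! j \<in> {cuts n Z ! (j - 1) + 1..cuts n Z ! j}" by simp
  then show "j \<in> block_index Z ` {1..n}"
    unfolding block_eq[OF Z j] by (auto intro!: image_eqI[where x = "cuts n Z ! j"])
qed

section \<open>Enumeration in reading order\<close>

lemma sorted_wrt_set_unique:
  assumes "sorted_wrt R xs" "sorted_wrt R ys" "set xs = set ys" "irreflp R" "asymp R"
  shows "xs = ys"
  using assms(1-3)
proof (induction xs arbitrary: ys)
  case (Cons x xs)
  then obtain y ys' where ys: "ys = y # ys'" by (cases ys) auto
  \<comment> \<open>Distinct heads would each lie in the tail of the other list and so precede each
    other.\<close>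
  have "x = y"
  proof (rule ccontr)
    assume "x \<noteq> y"
    then have "x \<in> set ys'" "y \<in> set xs" using Cons.prems(3) ys by auto
    then have "R x y" "R y x" using Cons.prems ys by auto
    with assms(5) show False by (meson asympD)
  qed
  moreover have "x \<notin> set xs" "y \<notin> set ys'"
    using Cons.prems ys assms(4) by (auto dest: irreflpD)
  ultimately have "set xs = set ys'" using Cons.prems(3) ys by (simp add: insert_ident)
  with Cons ys \<open>x = y\<close> show ?case by simp
qed simp

lemma box_list_eq:
  assumes "sorted_wrt reading_less bs"
  shows "box_list (set bs) = bs"
  unfolding box_list_def
proof (rule the_equality)
  fix cs
  assume "set cs = set bs \<and> sorted_wrt reading_less cs"
  then show "cs = bs"
    using assms by (intro sorted_wrt_set_unique[of reading_less])
      (auto simp: reading_less_def intro!: irreflpI asympI)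
qed (use assms in simp)

subsection \<open>The diagram of the algorithm\<close>

text \<open>\<open>S\<close> stands for \<open>comp_set \<alpha>\<close>; the last assumption then
  says, in terms of inversions, that \<open>w0_comp n \<alpha>\<close> lies below \<rho>.\<close>

context
  fixes n :: nat and \<rho> :: "nat \<Rightarrow> nat" and S :: "nat set"
  assumes \<rho>: "\<rho> permutes {1..n}"
    and S: "S \<subseteq> {1..<n}"
    and block_pairs: "block_pairs n S \<subseteq> inversions n \<rho>"
begin

definition row :: "nat \<Rightarrow> nat" where
  "row p = block_index ({1..<n} - S) p"

definition col :: "nat \<Rightarrow> nat" where
  "col p = block_index (Des_L n \<rho>) (\<rho> p)"

section \<open>Positions compared through their boxes\<close>

lemma Des_L_subset: "Des_L n \<rho> \<subseteq> {1..<n}"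
  by (auto simp: Des_L_def)

lemma row_mono: "p \<le> q \<Longrightarrow> row p \<le> row q"
  unfolding row_def by (rule block_index_mono) simp

lemma rho_image: "p \<in> {1..n} \<Longrightarrow> \<rho> p \<in> {1..n}"
  using permutes_in_image[OF \<rho>] by blast

text \<open>Equal block numbers leave no cut between the positions, and \<rho> inverts every pair
  inside a block.\<close>

lemma row_eq:
  assumes "p \<in> {1..n}" "q \<in> {1..n}" "p < q" "row p = row q"
  shows "(p, q) \<in> block_pairs n S" and "\<rho> q < \<rho> p"
proof -
  have "({1..<n} - S) \<inter> {p..<q} = {}"
    using assms unfolding row_def by (intro block_index_eq_imp) auto
  moreover have "{p..<q} \<subseteq> {1..<n}" using assms by auto
  ultimately have "{p..<q} \<subseteq> S" by blast
  with assms show "(p, q) \<in> block_pairs n S" by (simp add: block_pairs_def)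
  with block_pairs show "\<rho> q < \<rho> p" by (auto simp: inversions_def)
qed

lemma col_mono: "\<rho> p \<le> \<rho> q \<Longrightarrow> col p \<le> col q"
  unfolding col_def using Des_L_subset by (intro block_index_mono finite_subset[OF Des_L_subset]) simp_all

text \<open>No left descent of \<rho> separates the two values, so the inverse of \<rho> increases
  from one to the other.\<close>

lemma col_eq:
  assumes "p \<in> {1..n}" "q \<in> {1..n}" "\<rho> p < \<rho> q" "col p = col q"
  shows "p < q"
proof -
  have "Des_L n \<rho> \<inter> {\<rho> p..<\<rho> q} = {}"
    using assms(3,4) finite_subset[OF Des_L_subset] unfolding col_def
    by (intro block_index_eq_imp) auto
  moreover have "\<rho> p \<in> {1..n}" "\<rho> q \<in> {1..n}" using assms rho_image by blast+
  ultimately have "k \<in> {1..<n} \<and> k \<notin> Des_L n \<rho>" if "k \<in> {\<rho> p..<\<rho> q}" for k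
    using that by auto
  then have step: "inv' \<rho> k < inv' \<rho> (Suc k)" if "k \<in> {\<rho> p..<\<rho> q}" for k
    using that permutes_inv_neq[OF \<rho>, of k "Suc k"] unfolding Des_L_eq[OF \<rho>] by fastforce
  have "inv' \<rho> c < inv' \<rho> d" if "c < d" "{c..<d} \<subseteq> {\<rho> p..<\<rho> q}" for c d
    using that
  proof (induction rule: less_Suc_induct)
    case (1 i)
    then show ?case using step by simp
  next
    case (2 i j k)
    then have "{i..<j} \<subseteq> {i..<k}" "{j..<k} \<subseteq> {i..<k}" by auto
    with 2 show ?case by (meson less_trans order_trans)
  qed
  from this[OF assms(3)] show ?thesis by (simp add: permutes_inverses[OF \<rho>])
qed

lemma inj_on_box: "inj_on (\<lambda>p. (col p, row p)) {1..n}"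
proof (rule linorder_inj_onI)
  fix p q
  assume pq: "p < q" "p \<in> {1..n}" "q \<in> {1..n}"
  show "(col p, row p) \<noteq> (col q, row q)"
  proof
    assume "(col p, row p) = (col q, row q)"
    then have "\<rho> q < \<rho> p" "col p = col q" using row_eq pq by auto
    then have "q < p" using col_eq pq by simp
    with pq(1) show False by simp
  qed
qed auto

text \<open>If p < q and \<rho> dropped, monotonicity would force equal columns, where
  \<open>col_eq\<close> reverses the positions. If q < p, monotonicity forces equal rows.\<close>

lemma box_le_imp:
  assumes "p \<in> {1..n}" "q \<in> {1..n}" "p \<noteq> q" "col p \<le> col q" "row p \<le> row q"
  shows "p < q \<and> \<rho> p < \<rho> q \<or> (q, p) \<in> block_pairs n S"
proof (cases "p < q")
  case True
  have "\<rho> p < \<rho> q"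
  proof (rule ccontr)
    assume "\<not> ?thesis"
    then have less: "\<rho> q < \<rho> p"
      using assms(3) permutes_inj[OF \<rho>] by (metis injD linorder_neqE_nat)
    then have "col q = col p" using col_mono[of q p] assms(4) by simp
    with col_eq[of q p] less assms True show False by simp
  qed
  with True show ?thesis by simp
next
  case False
  then have "q < p" "row q = row p" using assms row_mono[of q p] by auto
  then show ?thesis using row_eq assms by blast
qed

text \<open>As positions descend, rows weakly descend; within a row \<rho> grows, so columns move
  right, strictly by \<open>inj_on_box\<close>.\<close>

lemma sorted_boxes: "sorted_wrt reading_less (map (\<lambda>p. (col p, row p)) (rev [1..<Suc n]))"
proof -
  have "reading_less (col q, row q) (col p, row p)"
    if pq: "p \<in> {1..n}" "q \<in> {1..n}" "p < q" for p q
  proof (cases "row p = row q")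
    case True
    then have "col q \<le> col p" using row_eq(2)[OF pq] col_mono by simp
    moreover have "col q \<noteq> col p" using inj_onD[OF inj_on_box, of p q] pq True by auto
    ultimately show ?thesis using True by (simp add: reading_less_def)
  next
    case False
    with row_mono[of p q] pq show ?thesis by (simp add: reading_less_def)
  qed
  then have "sorted_wrt (\<lambda>p q. reading_less (col q, row q) (col p, row p)) [1..<Suc n]"
    by (intro sorted_wrt_mono_rel[OF _ sorted_wrt_upt]) (auto simp del: upt_Suc)
  then show ?thesis by (simp only: sorted_wrt_map sorted_wrt_rev)
qed

lemma diagram_poset_boxes:
  "diagram_poset ((\<lambda>p. (col p, row p)) ` {1..n}) =
    {(i, j). i \<in> {1..n} \<and> j \<in> {1..n} \<and>
       col (reversal n i) \<le> col (reversal n j) \<and> row (reversal n i) \<le> row (reversal n j)}"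
proof -
  let ?D = "(\<lambda>p. (col p, row p)) ` {1..n}"
  have "?D = set (map (\<lambda>p. (col p, row p)) (rev [1..<Suc n]))"
    by (simp add: atLeastLessThanSuc_atLeastAtMost del: upt_Suc)
  then have "box_list ?D = map (\<lambda>p. (col p, row p)) (rev [1..<Suc n])"
    using box_list_eq[OF sorted_boxes] by simp
  \<comment> \<open>List indices start at 0, so entry i - 1 of the descending list belongs to
    position n + 1 - i.\<close>
  then have "box_list ?D ! (i - 1) = (col (reversal n i), row (reversal n i))" if "i \<in> {1..n}" for i
    using that by (auto simp: rev_nth reversal_def Suc_diff_le simp del: upt_Suc)
  moreover have "card ?D = n" using card_image[OF inj_on_box] by simp
  ultimately show ?thesis by (auto simp: diagram_poset_def)
qed

text \<open>The count follows from \<open>inj_on_box\<close>, and no row or column is skipped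
  because no block is empty.\<close>

lemma boxes_mem_diagrams: "(\<lambda>p. (col p, row p)) ` {1..n} \<in> diagrams n"
proof -
  have "fst ` (\<lambda>p. (col p, row p)) ` {1..n} = block_index (Des_L n \<rho>) ` \<rho> ` {1..n}"
    by (simp add: image_image col_def)
  moreover have "\<rho> ` {1..n} = {1..n}" by (rule permutes_image[OF \<rho>])
  moreover have "snd ` (\<lambda>p. (col p, row p)) ` {1..n} = block_index ({1..<n} - S) ` {1..n}"
    by (simp add: image_image row_def)
  moreover have "\<exists>l. block_index Z ` {1..n} = {1..l}" if "Z \<subseteq> {1..<n}" for Z
  proof (cases "n = 0")
    case True
    then show ?thesis by (intro exI[of _ 0]) simp
  next
    case False
    then show ?thesis using block_index_image[OF that] by blast
  qed
  ultimately show ?thesis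
    using Des_L_subset card_image[OF inj_on_box] by (simp add: diagrams_def)
qed

text \<open>A row block and a column block meet exactly in the values \<rho> p whose p has the given
  row and column.\<close>

lemma alg_diagram_eq:
  assumes "S = comp_set \<alpha>"
  shows "alg_diagram n \<alpha> \<rho> = (\<lambda>p. (col p, row p)) ` {1..n}"
proof -
  define Z where "Z = {1..<n} - S"
  have Z: "comp_set (comp_compl n \<alpha>) = Z"
    using assms by (simp add: Z_def comp_set_comp_compl)
  have Z_sub: "Z \<subseteq> {1..<n}" by (auto simp: Z_def)
  have row_block: "row_block n \<alpha> \<rho> j = \<rho> ` {p \<in> {1..n}. row p = j}" if "j \<in> {1..card Z + 1}" for j
    unfolding row_block_def Let_def Z block_eq[OF Z_sub that] row_def Z_def[symmetric] ..
  have col_block: "col_block n \<rho> i = {c \<in> {1..n}. block_index (Des_L n \<rho>) c = i}"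
    if "i \<in> {1..card (Des_L n \<rho>) + 1}" for i
    unfolding col_block_def Let_def block_eq[OF Des_L_subset that] ..
  have col_mem: "col p \<in> {1..card (Des_L n \<rho>) + 1}" if "p \<in> {1..n}" for p
    using block_index_image[OF Des_L_subset] rho_image[OF that] that unfolding col_def by force
  have row_mem: "row p \<in> {1..card Z + 1}" if "p \<in> {1..n}" for p
    using block_index_image[OF Z_sub] that unfolding row_def Z_def[symmetric] by force
  show ?thesis
  proof (intro Set.equalityI subsetI)
    fix b
    assume "b \<in> alg_diagram n \<alpha> \<rho>"
    then obtain i j where b: "b = (i, j)" "i \<in> {1..card (Des_L n \<rho>) + 1}" "j \<in> {1..card Z + 1}"
      "row_block n \<alpha> \<rho> j \<inter> col_block n \<rho> i \<noteq> {}"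
      unfolding alg_diagram_def Z by blast
    then obtain p where "p \<in> {1..n}" "row p = j" "col p = i"
      unfolding row_block[OF b(3)] col_block[OF b(2)] col_def by blast
    with b(1) show "b \<in> (\<lambda>p. (col p, row p)) ` {1..n}" by blast
  next
    fix b
    assume "b \<in> (\<lambda>p. (col p, row p)) ` {1..n}"
    then obtain p where p: "p \<in> {1..n}" "b = (col p, row p)" by blast
    have "\<rho> p \<in> row_block n \<alpha> \<rho> (row p) \<inter> col_block n \<rho> (col p)"
      unfolding row_block[OF row_mem[OF p(1)]] col_block[OF col_mem[OF p(1)]]
      using p(1) rho_image[OF p(1)] by (auto simp: col_def)
    then show "b \<in> alg_diagram n \<alpha> \<rho>"
      unfolding alg_diagram_def Z using p col_mem row_mem by blast
  qed
qed

text \<open>Pairs inside a block share a row with \<rho> decreasing, and pairs that \<rho> leaves in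
  order have comparable boxes by monotonicity. By \<open>box_le_imp\<close> no other boxes are
  comparable.\<close>

lemma box_extension_iff:
  assumes "\<gamma> permutes {1..n}"
  shows "(\<forall>p\<in>{1..n}. \<forall>q\<in>{1..n}. p \<noteq> q \<and> col p \<le> col q \<and> row p \<le> row q \<longrightarrow> \<gamma> p < \<gamma> q) \<longleftrightarrow>
    block_pairs n S \<subseteq> inversions n \<gamma> \<and> inversions n \<gamma> \<subseteq> inversions n \<rho>"
    (is "?L \<longleftrightarrow> ?R")
proof
  assume L: ?L
  show ?R
  proof (intro conjI subsetI; clarify)
    fix a b
    assume ab: "(a, b) \<in> block_pairs n S"
    then have mem: "a \<in> {1..n}" "b \<in> {1..n}" "a < b" "{a..<b} \<subseteq> S" by (auto simp: block_pairs_def)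
    have "\<rho> b < \<rho> a" using ab block_pairs by (auto simp: inversions_def)
    then have "col b \<le> col a" by (intro col_mono) simp
    moreover have "row b = row a"
    proof -
      \<comment> \<open>All of \<open>{a..<b}\<close> lies in S, so a cut below b is already below
        a.\<close>
      have "z < a" if "z \<notin> S" "z < b" for z
        using that mem(4) by (meson atLeastLessThan_iff not_less subsetD)
      then have "{z \<in> {1..<n} - S. z < b} = {z \<in> {1..<n} - S. z < a}"
        using mem(3) by auto
      then show ?thesis by (simp add: row_def block_index_def)
    qed
    ultimately have "\<gamma> b < \<gamma> a" using bspec[OF bspec[OF L mem(2)] mem(1)] mem(3) by simp
    with mem show "(a, b) \<in> inversions n \<gamma>" by (auto simp: inversions_def)
  next
    fix a b
    assume "(a, b) \<in> inversions n \<gamma>"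
    then have ab: "a \<in> {1..n}" "b \<in> {1..n}" "a < b" "\<gamma> b < \<gamma> a" by (auto simp: inversions_def)
    have "\<rho> b < \<rho> a"
    proof (rule ccontr)
      assume "\<not> ?thesis"
      then have "col a \<le> col b" "row a \<le> row b" using ab col_mono row_mono by simp_all
      then have "\<gamma> a < \<gamma> b" using bspec[OF bspec[OF L ab(1)] ab(2)] ab(3) by simp
      with ab(4) show False by simp
    qed
    with ab show "(a, b) \<in> inversions n \<rho>" by (auto simp: inversions_def)
  qed
next
  assume R: ?R
  show ?L
  proof (intro ballI impI)
    fix p q
    assume pq: "p \<in> {1..n}" "q \<in> {1..n}" "p \<noteq> q \<and> col p \<le> col q \<and> row p \<le> row q"
    then consider "p < q" "\<rho> p < \<rho> q" | "(q, p) \<in> block_pairs n S"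
      using box_le_imp by blast
    then show "\<gamma> p < \<gamma> q"
    proof cases
      case 1
      then have "(p, q) \<notin> inversions n \<gamma>" using R by (auto simp: inversions_def)
      then have "\<not> \<gamma> q < \<gamma> p" using 1 pq by (auto simp: inversions_def)
      moreover have "\<gamma> p \<noteq> \<gamma> q" using pq permutes_inj[OF assms] by (auto dest: injD)
      ultimately show ?thesis by simp
    next
      case 2
      then show ?thesis using R by (auto simp: inversions_def)
    qed
  qed
qed

text \<open>Substituting positions \<open>reversal n i\<close> for labels i turns the linear
  extension condition on w0 \<gamma>^-1 into the left side of
  \<open>box_extension_iff\<close>.\<close>

lemma Sigma_R_boxes:
  assumes "\<sigma> permutes {1..n}" "inversions n \<sigma> = block_pairs n S"
  shows "Sigma_R n (diagram_poset ((\<lambda>p. (col p, row p)) ` {1..n})) =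
    {w0 n \<circ> inv' \<gamma> | \<gamma>. \<gamma> \<in> interval_L n \<sigma> \<rho>}"
proof -
  let ?\<Sigma> = "Sigma_R n (diagram_poset ((\<lambda>p. (col p, row p)) ` {1..n}))"
  have mem: "reversal n \<circ> inv' \<gamma> \<in> ?\<Sigma> \<longleftrightarrow> \<gamma> \<in> interval_L n \<sigma> \<rho>" if "\<gamma> permutes {1..n}" for \<gamma>
  proof -
    have "reversal n \<circ> inv' \<gamma> \<in> ?\<Sigma> \<longleftrightarrow>
        (\<forall>i j. (i \<in> {1..n} \<and> j \<in> {1..n} \<and> col (reversal n i) \<le> col (reversal n j)
           \<and> row (reversal n i) \<le> row (reversal n j)) \<and> i \<noteq> j
           \<longrightarrow> \<gamma> (reversal n i) < \<gamma> (reversal n j))"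
      unfolding Sigma_R_def diagram_poset_boxes sym_group_carrier
      by (simp only: mem_Collect_eq prod.case inv_reversal_comp_inv[OF that] o_apply reversal_comp_inv_permutes[OF that] simp_thms)
    also have "\<dots> \<longleftrightarrow>
        (\<forall>i\<in>{1..n}. \<forall>j\<in>{1..n}. i \<noteq> j \<and> col (reversal n i) \<le> col (reversal n j)
           \<and> row (reversal n i) \<le> row (reversal n j) \<longrightarrow> \<gamma> (reversal n i) < \<gamma> (reversal n j))"
      by (simp only: Ball_def imp_conjL conj_assoc) blast
    also have "\<dots> \<longleftrightarrow> (\<forall>p\<in>reversal n ` {1..n}. \<forall>q\<in>reversal n ` {1..n}.
        p \<noteq> q \<and> col p \<le> col q \<and> row p \<le> row q \<longrightarrow> \<gamma> p < \<gamma> q)"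
      by (simp only: ball_simps reversal_eq_iff)
    also have "\<dots> \<longleftrightarrow>
        (\<forall>p\<in>{1..n}. \<forall>q\<in>{1..n}. p \<noteq> q \<and> col p \<le> col q \<and> row p \<le> row q \<longrightarrow> \<gamma> p < \<gamma> q)"
      unfolding permutes_image[OF reversal_permutes] ..
    also have "\<dots> \<longleftrightarrow> \<gamma> \<in> interval_L n \<sigma> \<rho>"
      unfolding box_extension_iff[OF that] interval_L_def mem_Collect_eq sym_group_carrier
        weak_le_L_iff[OF assms(1)] weak_le_L_iff[OF that] assms(2)
      using that \<rho> by blast
    finally show ?thesis .
  qed
  show ?thesis
    unfolding w0_eq_reversal
  proof (intro Set.equalityI subsetI)
    fix \<tau>
    assume \<tau>: "\<tau> \<in> ?\<Sigma>"
    then obtain \<gamma> where "\<tau> = reversal n \<circ> inv' \<gamma>" "\<gamma> permutes {1..n}"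
      using reversal_comp_inv_surj[of \<tau>] unfolding Sigma_R_def sym_group_carrier by blast
    then show "\<tau> \<in> {reversal n \<circ> inv' \<gamma> | \<gamma>. \<gamma> \<in> interval_L n \<sigma> \<rho>}"
      using mem[of \<gamma>] \<tau> by blast
  next
    fix \<tau>
    assume "\<tau> \<in> {reversal n \<circ> inv' \<gamma> | \<gamma>. \<gamma> \<in> interval_L n \<sigma> \<rho>}"
    then obtain \<gamma> where "\<tau> = reversal n \<circ> inv' \<gamma>" "\<gamma> \<in> interval_L n \<sigma> \<rho>" by blast
    then show "\<tau> \<in> ?\<Sigma>"
      using mem[of \<gamma>] unfolding interval_L_def sym_group_carrier by blast
  qed
qed

end

theorem theorem5p6:
  fixes n :: nat and \<alpha> :: "nat list" and \<rho> :: "nat \<Rightarrow> nat"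
  assumes "composition_of n \<alpha>"
    and "\<rho> \<in> carrier (sym_group n)"
    and "weak_le_L n (w0_comp n \<alpha>) \<rho>"
  shows "alg_diagram n \<alpha> \<rho> \<in> diagrams n
    \<and> Sigma_R n (diagram_poset (alg_diagram n \<alpha> \<rho>))
        = {w0 n \<circ> inv' \<gamma> | \<gamma>. \<gamma> \<in> interval_L n (w0_comp n \<alpha>) \<rho>}
    \<and> {w0 n \<circ> inv' \<gamma> | \<gamma>. \<gamma> \<in> interval_L n (w0_comp n \<alpha>) \<rho>}
        = interval_R n (w0 n \<circ> inv' \<rho>) (w0 n \<circ> inv' (w0_comp n \<alpha>))"
proof -
  have \<rho>: "\<rho> permutes {1..n}" using assms(2) by (simp only: sym_group_carrier)
  note S = comp_set_subset[OF assms(1)]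
  note w = longest_generate[OF S, folded w0_comp_def]
  \<comment> \<open>The inversions of \<open>w0_comp n \<alpha>\<close> are the block pairs, so the
    hypothesis on \<rho> becomes the last assumption of the context.\<close>
  have "block_pairs n (comp_set \<alpha>) \<subseteq> inversions n \<rho>"
    using assms(3) unfolding weak_le_L_iff[OF w(1)] w(2) by blast
  note ctxt = \<rho> S this
  show ?thesis
    unfolding alg_diagram_eq[OF ctxt refl]
    using boxes_mem_diagrams[OF ctxt] Sigma_R_boxes[OF ctxt w] interval_L_reversal[OF w(1) \<rho>]
    by blast
qed

end
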